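(* Let $c \geqslant 3$ be an integer and let $D$ be a (finite) strong $c$-partite tournament. Then $D$ contains two distinct arcs $e^1, e^2$ such that for each $k \in \{1,2\}$ there exist cycles $C_3^k, C_4^k, \ldots, C_c^k$ in $D$, where for each $m \in \{3,4,\ldots,c\}$ the cycle $C_m^k$ has length $m$ and contains the arc $e^k$, and $V(C_3^k) \subset V(C_4^k) \subset \cdots \subset V(C_c^k)$.
   Context: All digraphs are finite, without loops or multiple arcs. A $c$-partite tournament is an orientation of a complete $c$-partite graph: the vertex set is partitioned into $c$ nonempty partite sets, there is no arc between two vertices in the same partite set, and for any two vertices $x,y$ in different partite sets exactly one of the arcs $xy$, $yx$ is present. A digraph is strong (strongly connected) if for each ordered pair of vertices $u,v$ there is a directed path from $u$ to $v$. A cycle means a simple directed cycle (no repeated vertices); its length is its number of arcs (equivalently, of vertices), and a cycle of length $m$ is called an $m$-cycle. $V(C)$ denotes the vertex set of a cycle $C$. *)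

theory Defs
  imports "Graph_Theory.Digraph_Component" "HOL-Library.Disjoint_Sets"
begin

text \<open>
  The locale \<^locale>\<open>digraph\<close> already excludes infinite digraphs, loops and parallel arcs;
  \<^const>\<open>partition_on\<close> makes the partite sets nonempty and pairwise disjoint.
\<close>

locale multipartite_tournament = digraph D
  for D :: "('a, 'b) pre_digraph" (structure) +
  fixes c :: nat and P :: "'a set set"
  assumes partite_sets: "partition_on (verts D) P"
    and card_partite_sets: "card P = c"
    and no_arc_within: "\<lbrakk>X \<in> P; x \<in> X; y \<in> X\<rbrakk> \<Longrightarrow> \<not> x \<rightarrow> y"
    and one_arc_between: "\<lbrakk>X \<in> P; Y \<in> P; X \<noteq> Y; x \<in> X; y \<in> Y\<rbrakk> \<Longrightarrow> (x \<rightarrow> y) \<noteq> (y \<rightarrow> x)"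

text \<open>
  A cycle is a nonempty list of arcs, so its length is its number of arcs. The start vertex
  passed to \<^const>\<open>pre_digraph.awalk_verts\<close> is determined by the first arc.
\<close>

definition (in pre_digraph) cycle_verts :: "'b awalk \<Rightarrow> 'a set" where
  "cycle_verts p = set (awalk_verts (tail G (hd p)) p)"

end

theory Submission
  imports Defs
begin

text \<open>
  Call an arc of an m-cycle C good if nested cycles of lengths 3, ..., m through it end in C.
  Suppose that C has two good arcs and let x be a vertex in a partite set avoiding C. If x
  can be inserted into
  an arc (a, b) of C, any good arc other than (a, b) stays good. If (a, b) itself was good, let y
  be the third vertex of its 3-cycle: depending on the direction between x and y, one of (a, x) and
  (x, b) is contained in a 3-cycle on a, b, x, y and hence is good. If no such vertex can be
  inserted, each of them dominates C or is dominated by C. A shortest walk leading from C through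
  such a vertex back to C then yields a completely new chain: in a path all of whose vertices
  beyond the second dominate the first one, every initial segment of length at least 3 closes up to
  a cycle through the first two arcs.
\<close>

section \<open>Cycles as vertex lists, and chains of cycles through a fixed arc\<close>

definition cycle_arcs :: "'a list \<Rightarrow> ('a \<times> 'a) set" where
  "cycle_arcs xs = set (zip xs (rotate1 xs))"

definition is_cycle :: "('a \<Rightarrow> 'a \<Rightarrow> bool) \<Rightarrow> 'a list \<Rightarrow> bool" where
  "is_cycle E xs \<longleftrightarrow> distinct xs \<and> (\<forall>(a, b)\<in>cycle_arcs xs. E a b)"

text \<open>Only the last cycle is recorded. Consecutive cycles are tied by their vertex sets and
  \<open>e\<close> alone, so each may be listed from any starting vertex.\<close>

inductive cycle_chain :: "('a \<Rightarrow> 'a \<Rightarrow> bool) \<Rightarrow> 'a \<times> 'a \<Rightarrow> 'a list \<Rightarrow> bool"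
  for E e where
  triangle: "is_cycle E xs \<Longrightarrow> length xs = 3 \<Longrightarrow> e \<in> cycle_arcs xs \<Longrightarrow> cycle_chain E e xs"
| extend: "cycle_chain E e xs \<Longrightarrow> is_cycle E ys \<Longrightarrow> length ys = Suc (length xs) \<Longrightarrow>
    set xs \<subset> set ys \<Longrightarrow> e \<in> cycle_arcs ys \<Longrightarrow> cycle_chain E e ys"

text \<open>Both chains end in the same cycle, which is more than the theorem asks: one vertex
  inserted into it can then prolong both at once.\<close>

definition chain_pair :: "('a \<Rightarrow> 'a \<Rightarrow> bool) \<Rightarrow> nat \<Rightarrow> bool" where
  "chain_pair E n \<longleftrightarrow> (\<exists>xs e1 e2. length xs = n \<and> e1 \<noteq> e2 \<and> cycle_chain E e1 xs \<and> cycle_chain E e2 xs)"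

section \<open>Arcs of a cyclic list under rotation and reversal\<close>

lemma cycle_arcs_mod:
  "cycle_arcs xs = {(xs ! i, xs ! (Suc i mod length xs)) | i. i < length xs}"
  by (auto simp: cycle_arcs_def set_zip nth_rotate1)

lemma cycle_arcs_nth:
  assumes "xs \<noteq> []"
  shows "cycle_arcs xs = {(xs ! i, xs ! Suc i) | i. Suc i < length xs} \<union> {(last xs, hd xs)}"
proof -
  obtain k where k: "length xs = Suc k" using assms by (cases xs) auto
  have "last xs = xs ! k" "hd xs = xs ! 0" using k assms by (auto simp: last_conv_nth hd_conv_nth)
  moreover have "{(xs ! i, xs ! (Suc i mod Suc k)) | i. i < Suc k} =
      (\<lambda>i. (xs ! i, xs ! (Suc i mod Suc k))) ` insert k {..<k}"
    by (auto simp: less_Suc_eq)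
  moreover have "\<dots> = {(xs ! i, xs ! Suc i) | i. i < k} \<union> {(xs ! k, xs ! 0)}"
    by auto
  ultimately show ?thesis unfolding cycle_arcs_mod k by simp
qed

lemma cycle_arcs_rotate [simp]: "cycle_arcs (rotate n xs) = cycle_arcs xs"
proof (induction n)
  case (Suc n)
  have zip_rotate1: "length xs = length ys \<Longrightarrow> zip (rotate1 xs) (rotate1 ys) = rotate1 (zip xs ys)"
    for xs ys :: "'a list"
    by (cases xs; cases ys) auto
  then show ?case using Suc by (simp add: cycle_arcs_def)
qed simp

lemma is_cycle_rotate [simp]: "is_cycle E (rotate n xs) = is_cycle E xs"
  by (simp add: is_cycle_def)

lemma cycle_arcs_rev: "cycle_arcs (rev xs) = prod.swap ` cycle_arcs xs"
proof (cases "xs = []")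
  case False
  have "{(rev xs ! i, rev xs ! Suc i) | i. Suc i < length xs} =
      prod.swap ` {(xs ! i, xs ! Suc i) | i. Suc i < length xs}" (is "?L = ?R")
  proof
    show "?L \<subseteq> ?R"
    proof
      fix p assume "p \<in> ?L"
      then obtain i where i: "Suc i < length xs" "p = (rev xs ! i, rev xs ! Suc i)" by blast
      define k where "k = length xs - Suc (Suc i)"
      have "p = prod.swap (xs ! k, xs ! Suc k)" "Suc k < length xs"
        using i by (auto simp: k_def rev_nth Suc_diff_Suc)
      then show "p \<in> ?R" by blast
    qed
    show "?R \<subseteq> ?L"
    proof
      fix p assume "p \<in> ?R"
      then obtain i where i: "Suc i < length xs" "p = (xs ! Suc i, xs ! i)" by auto
      define k where "k = length xs - Suc (Suc i)"
      have "p = (rev xs ! k, rev xs ! Suc k)" "Suc k < length xs"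
        using i by (auto simp: k_def rev_nth Suc_diff_Suc)
      then show "p \<in> ?L" by blast
    qed
  qed
  with False show ?thesis
    by (simp add: cycle_arcs_nth hd_rev last_rev image_Un)
qed (simp add: cycle_arcs_def)

lemma is_cycle_rev: "is_cycle (\<lambda>x y. E y x) xs \<Longrightarrow> is_cycle E (rev xs)"
  by (auto simp: is_cycle_def cycle_arcs_rev)

lemma cycle_chain_rev: "cycle_chain (\<lambda>x y. E y x) e xs \<Longrightarrow> cycle_chain E (prod.swap e) (rev xs)"
proof (induction rule: cycle_chain.induct)
  case (triangle xs)
  then show ?case by (intro cycle_chain.triangle is_cycle_rev) (auto simp: cycle_arcs_rev)
next
  case (extend xs ys)
  then show ?case
    by (intro cycle_chain.extend[OF extend.IH is_cycle_rev]) (auto simp: cycle_arcs_rev)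
qed

text \<open>Reversing the cycles swaps the ends of every arc, and swapping keeps two arcs distinct.
  This duality reduces vertices that dominate a cycle to vertices dominated by it.\<close>

lemma chain_pair_converse: "chain_pair (\<lambda>x y. E y x) n \<Longrightarrow> chain_pair E n"
  unfolding chain_pair_def by (metis cycle_chain_rev length_rev swap_swap)

lemma cycle_chain_is_cycle:
  assumes "cycle_chain E e xs"
  shows "is_cycle E xs" "e \<in> cycle_arcs xs" "length xs \<ge> 3"
  using assms by (induction rule: cycle_chain.induct) auto

lemma cycle_chain_rotate: "cycle_chain E e xs \<Longrightarrow> cycle_chain E e (rotate n xs)"
proof (induction rule: cycle_chain.induct)
  case (extend xs ys)
  then show ?case by (intro cycle_chain.extend[OF extend.IH]) auto
qed (auto intro: cycle_chain.triangle)

text \<open>Makes a given arc the closing one, from the last vertex to the first, so that inserting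
  a vertex into it is just a \<open>Cons\<close>.\<close>

lemma rotate_to_arc:
  assumes "(a, b) \<in> cycle_arcs xs"
  obtains n where "hd (rotate n xs) = b" "last (rotate n xs) = a"
proof -
  obtain i where i: "i < length xs" "a = xs ! i" "b = xs ! (Suc i mod length xs)"
    using assms by (auto simp: cycle_arcs_mod)
  then have "xs \<noteq> []" by auto
  have "last (rotate (Suc i) xs) = xs ! ((Suc i + (length xs - 1)) mod length xs)"
    using \<open>xs \<noteq> []\<close> by (simp add: last_conv_nth nth_rotate add.commute del: rotate_Suc)
  also have "Suc i + (length xs - 1) = i + length xs" using i by simp
  also have "(i + length xs) mod length xs = i" using i by simp
  finally show thesis using i \<open>xs \<noteq> []\<close>
    by (intro that[of "Suc i"]) (simp_all add: hd_rotate_conv_nth del: rotate_Suc)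
qed

lemma rotate_to_hd:
  assumes "a \<in> set xs"
  obtains n where "hd (rotate n xs) = a"
proof -
  obtain i where "i < length xs" "xs ! i = a" using assms by (auto simp: in_set_conv_nth)
  moreover from this have "xs \<noteq> []" by auto
  ultimately show thesis by (intro that[of i]) (simp add: hd_rotate_conv_nth)
qed

text \<open>After \<open>a\<close> is rotated to the front, \<open>Q\<close> spreads by induction
  along the list. It serves to show that an outside vertex relates uniformly to a whole
  cycle.\<close>

lemma cycle_closed:
  assumes "a \<in> set xs" "Q a" "\<And>u v. (u, v) \<in> cycle_arcs xs \<Longrightarrow> Q u \<Longrightarrow> Q v" "b \<in> set xs"
  shows "Q b"
proof -
  obtain n where n: "hd (rotate n xs) = a" using rotate_to_hd assms(1) .
  let ?ys = "rotate n xs"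
  have ne: "?ys \<noteq> []" using assms by auto
  have "i < length xs \<Longrightarrow> Q (?ys ! i)" for i
  proof (induction i)
    case 0 then show ?case using n ne assms(2) by (simp add: hd_conv_nth)
  next
    case (Suc i)
    then have "(?ys ! i, ?ys ! Suc i) \<in> cycle_arcs ?ys" unfolding cycle_arcs_nth[OF ne] by auto
    with Suc assms(3) show ?case by simp
  qed
  moreover have "b \<in> set ?ys" using assms by simp
  ultimately show ?thesis by (metis in_set_conv_nth length_rotate)
qed

section \<open>Inserting a vertex into an arc of a cycle\<close>

lemma cycle_arcs_Cons:
  assumes "xs \<noteq> []"
  shows "cycle_arcs (x # xs) =
    {(xs ! i, xs ! Suc i) | i. Suc i < length xs} \<union> {(x, hd xs), (last xs, x)}"
proof -
  have "{((x # xs) ! i, (x # xs) ! Suc i) | i. Suc i < length (x # xs)} =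
     {(xs ! i, xs ! Suc i) | i. Suc i < length xs} \<union> {(x, hd xs)}" (is "?L = ?R")
  proof
    show "?L \<subseteq> ?R"
    proof
      fix p assume "p \<in> ?L"
      then obtain i where "p = ((x # xs) ! i, (x # xs) ! Suc i)" "Suc i < length (x # xs)" by blast
      then show "p \<in> ?R" using assms by (cases i) (auto simp: hd_conv_nth)
    qed
    show "?R \<subseteq> ?L"
    proof
      fix p assume "p \<in> ?R"
      then consider i where "p = (xs ! i, xs ! Suc i)" "Suc i < length xs" | "p = (x, hd xs)" by auto
      then show "p \<in> ?L"
      proof cases
        case (1 i) then show ?thesis by (auto intro!: exI[of _ "Suc i"])
      next
        case 2 then show ?thesis using assms by (auto intro!: exI[of _ 0] simp: hd_conv_nth)
      qed
    qed
  qed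
  then show ?thesis using assms by (auto simp: cycle_arcs_nth)
qed

lemma is_cycle_insert:
  assumes "is_cycle E xs" "xs \<noteq> []" "x \<notin> set xs" "E (last xs) x" "E x (hd xs)"
  shows "is_cycle E (x # xs)"
  using assms unfolding is_cycle_def cycle_arcs_Cons[OF assms(2)] cycle_arcs_nth[OF assms(2)]
  by auto

text \<open>The insertion destroys only the closing arc, so \<open>e\<close> survives and the
  enlarged cycle becomes the new last member of the chain.\<close>

lemma cycle_chain_insert:
  assumes "cycle_chain E e xs" "x \<notin> set xs" "E (last xs) x" "E x (hd xs)" "e \<noteq> (last xs, hd xs)"
  shows "cycle_chain E e (x # xs)"
proof (rule cycle_chain.extend[OF assms(1)])
  have ne: "xs \<noteq> []" using cycle_chain_is_cycle(3)[OF assms(1)] by auto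
  show "is_cycle E (x # xs)" using assms ne cycle_chain_is_cycle(1)[OF assms(1)] by (intro is_cycle_insert) auto
  show "e \<in> cycle_arcs (x # xs)"
    using cycle_chain_is_cycle(2)[OF assms(1)] assms(5)
    unfolding cycle_arcs_Cons[OF ne] cycle_arcs_nth[OF ne] by auto
qed (use assms in auto)

text \<open>Here the good arc itself is destroyed, so the chain is rebuilt: first a new triangle
  containing \<open>x\<close>, then every old cycle with \<open>x\<close> inserted into
  \<open>(a, b)\<close>. Whichever of the two new arcs the triangle selects lies on all these
  cycles.\<close>

lemma cycle_chain_insert_at_arc:
  assumes "cycle_chain E (a, b) xs" "x \<notin> set xs" "E a x" "E x b" "\<And>y. y \<in> set xs \<Longrightarrow> E x y \<or> E y x"
    and "hd (rotate n xs) = b" "last (rotate n xs) = a"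
  shows "\<exists>e\<in>{(a, x), (x, b)}. cycle_chain E e (x # rotate n xs)"
  using assms
proof (induction arbitrary: n rule: cycle_chain.induct)
  case (triangle xs)
  let ?ys = "rotate n xs"
  have len: "length ?ys = 3" and cyc: "is_cycle E ?ys" and nx: "x \<notin> set ?ys"
    using triangle by auto
  have "\<exists>y. zs = [b, y, a]" if "length zs = 3" "hd zs = b" "last zs = a" for zs
    using that by (auto simp: numeral_3_eq_3 length_Suc_conv)
  then obtain y where ys: "?ys = [b, y, a]"
    using len triangle.prems(5,6) by blast
  then have "set xs = {b, y, a}" by (metis set_rotate list.set(1,2))
  with ys have y: "E b y" "E y a" "y \<in> set xs" "distinct [b, y, a]" "x \<notin> {b, y, a}"
    using cyc nx by (auto simp: is_cycle_def cycle_arcs_def)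
  have big: "is_cycle E (x # ?ys)"
    using triangle.prems ys nx cyc by (intro is_cycle_insert) auto
  have "E x y \<or> E y x" using triangle.prems y by auto
  then show ?case
  proof
    assume "E x y"
    then have "cycle_chain E (a, x) [x, y, a]"
      using y triangle.prems by (intro cycle_chain.triangle) (auto simp: is_cycle_def cycle_arcs_def)
    then have "cycle_chain E (a, x) (x # ?ys)"
      by (rule cycle_chain.extend) (use big y in \<open>auto simp: ys cycle_arcs_def\<close>)
    then show ?case by blast
  next
    assume "E y x"
    then have "cycle_chain E (x, b) [x, b, y]"
      using y triangle.prems by (intro cycle_chain.triangle) (auto simp: is_cycle_def cycle_arcs_def)
    then have "cycle_chain E (x, b) (x # ?ys)"
      by (rule cycle_chain.extend) (use big y in \<open>auto simp: ys cycle_arcs_def\<close>)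
    then show ?case by blast
  qed
next
  case (extend xs ys)
  \<comment> \<open>The arc \<open>(a, b)\<close> sits at its own position on the smaller cycle,
    hence a separate rotation.\<close>
  obtain k where k: "hd (rotate k xs) = b" "last (rotate k xs) = a"
    using rotate_to_arc cycle_chain_is_cycle(2)[OF extend.hyps(1)] .
  have sub: "set xs \<subset> set ys" by fact
  obtain e where e: "e \<in> {(a, x), (x, b)}" "cycle_chain E e (x # rotate k xs)"
    using extend.IH[OF _ _ _ _ k] extend.prems sub by blast
  have ne: "rotate n ys \<noteq> []" using extend.hyps by auto
  have "is_cycle E (x # rotate n ys)"
    using extend.hyps extend.prems ne by (intro is_cycle_insert) auto
  moreover have "set (x # rotate k xs) \<subset> set (x # rotate n ys)"
  proof -
    have "x \<notin> set xs" "x \<notin> set ys" using sub extend.prems by auto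
    with sub show ?thesis by auto
  qed
  moreover have "e \<in> cycle_arcs (x # rotate n ys)"
    using e(1) extend.prems by (auto simp: cycle_arcs_Cons[OF ne])
  ultimately have "cycle_chain E e (x # rotate n ys)"
    using extend.hyps by (intro cycle_chain.extend[OF e(2)]) auto
  with e show ?case by blast
qed

lemma chain_pair_insert:
  assumes "cycle_chain E e1 xs" "cycle_chain E e2 xs" "e1 \<noteq> e2" "x \<notin> set xs"
    and "\<And>y. y \<in> set xs \<Longrightarrow> E x y \<or> E y x"
    and "(a, b) \<in> cycle_arcs xs" "E a x" "E x b"
  shows "chain_pair E (Suc (length xs))"
proof -
  obtain n where n: "hd (rotate n xs) = b" "last (rotate n xs) = a"
    using rotate_to_arc assms(6) .
  let ?ys = "rotate n xs"
  \<comment> \<open>The enlarged cycle is the same for both good arcs; only the surviving arc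
    \<open>e'\<close> depends on \<open>e\<close>.\<close>
  have *: "\<exists>e'. cycle_chain E e' (x # ?ys) \<and> (if e = (a, b) then e' \<in> {(a, x), (x, b)} else e' = e)"
    if "cycle_chain E e xs" for e
  proof (cases "e = (a, b)")
    case True
    then show ?thesis using cycle_chain_insert_at_arc[of E a b xs x n] that assms n by auto
  next
    case False
    then have "cycle_chain E e (x # ?ys)"
      using cycle_chain_rotate[OF that] assms n by (intro cycle_chain_insert) auto
    with False show ?thesis by (intro exI[of _ e]) simp
  qed
  obtain f1 where f1: "cycle_chain E f1 (x # ?ys)" "if e1 = (a, b) then f1 \<in> {(a, x), (x, b)} else f1 = e1"
    using *[OF assms(1)] by auto
  obtain f2 where f2: "cycle_chain E f2 (x # ?ys)" "if e2 = (a, b) then f2 \<in> {(a, x), (x, b)} else f2 = e2"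
    using *[OF assms(2)] by auto
  have "fst e \<in> set xs \<and> snd e \<in> set xs" if "e \<in> cycle_arcs xs" for e
    using that by (auto simp: cycle_arcs_mod intro!: nth_mem mod_less_divisor)
  then have old: "fst e1 \<noteq> x" "snd e1 \<noteq> x" "fst e2 \<noteq> x" "snd e2 \<noteq> x"
    using assms(4) cycle_chain_is_cycle(2)[OF assms(1)] cycle_chain_is_cycle(2)[OF assms(2)] by metis+
  \<comment> \<open>As \<open>e1\<close> and \<open>e2\<close> differ, at most one of them is the
    destroyed arc \<open>(a, b)\<close>. Its replacement has \<open>x\<close> as an end, which no
    arc of \<open>xs\<close> has.\<close>
  have "f1 \<noteq> f2"
  proof (cases "e1 = (a, b)")
    case True
    then have "fst f1 = x \<or> snd f1 = x" "f2 = e2" using f1(2) f2(2) assms(3) by auto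
    then show ?thesis using old by auto
  next
    case False
    then have "f1 = e1" "f2 = e2 \<or> fst f2 = x \<or> snd f2 = x" using f1(2) f2(2) by (auto split: if_splits)
    then show ?thesis using old assms(3) by auto
  qed
  then show ?thesis unfolding chain_pair_def
    using f1(1) f2(1) by (intro exI[of _ "x # ?ys"] exI[of _ f1] exI[of _ f2]) simp
qed

section \<open>Chains from the initial segments of a path\<close>

lemma chain_pair_prefix:
  assumes "distinct q" "successively E q" "\<And>j. 2 \<le> j \<Longrightarrow> j < length q \<Longrightarrow> E (q ! j) (q ! 0)"
    and "3 \<le> n" "n \<le> length q"
  shows "chain_pair E n"
proof -
  have q: "E (q ! i) (q ! Suc i)" if "Suc i < length q" for i
    using assms(2) that by (simp add: successively_conv_nth)
  \<comment> \<open>The prefix of \<open>n\<close> vertices is closed by the arc from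
    \<open>q ! (n - 1)\<close> to \<open>q ! 0\<close>, present since \<open>n - 1\<close> is at
    least 2. For the same reason the first two arcs of the path lie inside the prefix.\<close>
  have cyc: "is_cycle E (take n q)" and arcs: "(q ! 0, q ! 1) \<in> cycle_arcs (take n q)"
    "(q ! 1, q ! 2) \<in> cycle_arcs (take n q)" if "3 \<le> n" "n \<le> length q" for n
  proof -
    have *: "take n q \<noteq> []" using that by auto
    have "E (q ! (n - 1)) (q ! 0)" using that by (intro assms(3)) auto
    then show "is_cycle E (take n q)"
      using q that assms(1) by (auto simp: is_cycle_def cycle_arcs_nth[OF *] hd_conv_nth[OF *] last_conv_nth[OF *] min_def)
    show "(q ! 0, q ! 1) \<in> cycle_arcs (take n q)"
      unfolding cycle_arcs_nth[OF *] using that by (auto intro!: exI[of _ 0])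
    show "(q ! 1, q ! 2) \<in> cycle_arcs (take n q)"
      unfolding cycle_arcs_nth[OF *] using that by (auto intro!: exI[of _ 1] simp: numeral_2_eq_2)
  qed
  have "cycle_chain E (q ! 0, q ! 1) (take n q) \<and> cycle_chain E (q ! 1, q ! 2) (take n q)"
    using assms(4,5)
  proof (induction n rule: dec_induct)
    case base
    then show ?case using cyc[of 3] arcs[of 3] by (auto intro!: cycle_chain.triangle)
  next
    case (step n)
    have "set (take (Suc n) q) = insert (q ! n) (set (take n q))"
      using step by (simp add: take_Suc_conv_app_nth)
    moreover have "q ! n \<notin> set (take n q)"
      using distinct_take[OF assms(1), of "Suc n"] step by (simp add: take_Suc_conv_app_nth)
    ultimately have "set (take n q) \<subset> set (take (Suc n) q)" by auto
    then show ?case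
      using step cyc[of "Suc n"] arcs[of "Suc n"] by (auto intro!: cycle_chain.extend[of E _ "take n q"])
  qed
  moreover have "q ! 0 \<noteq> q ! 1"
  proof -
    have "0 < length q" "1 < length q" using assms(4,5) by linarith+
    then show ?thesis using nth_eq_iff_index_eq[OF assms(1), of 0 1] by simp
  qed
  ultimately show ?thesis
    using assms(5) unfolding chain_pair_def
    by (intro exI[of _ "take n q"] exI[of _ "(q ! 0, q ! 1)"] exI[of _ "(q ! 1, q ! 2)"]) auto
qed

section \<open>Walks along cycles and reachability\<close>

lemma is_cycle_successively: "is_cycle E xs \<Longrightarrow> successively E xs"
proof (cases "xs = []")
  case False
  assume "is_cycle E xs"
  then show ?thesis
    unfolding is_cycle_def cycle_arcs_nth[OF False] successively_conv_nth by blast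
qed simp

lemma is_cycle_out_arc:
  assumes "d \<in> set xs"
  obtains d' where "d' \<in> set xs" "(d, d') \<in> cycle_arcs xs"
proof -
  obtain i where i: "i < length xs" "d = xs ! i" using assms by (auto simp: in_set_conv_nth)
  then have "xs ! (Suc i mod length xs) \<in> set xs" by (intro nth_mem mod_less_divisor) auto
  with i that show thesis by (auto simp: cycle_arcs_mod)
qed

lemma rtranclp_walk:
  assumes "E\<^sup>*\<^sup>* x y"
  shows "\<exists>q. q \<noteq> [] \<and> hd q = x \<and> last q = y \<and> successively E q"
  using assms
proof (induction rule: rtranclp_induct)
  case base
  then show ?case by (intro exI[of _ "[x]"]) auto
next
  case (step y z)
  then obtain q where "q \<noteq> []" "hd q = x" "last q = y" "successively E q" by blast
  with step show ?case by (intro exI[of _ "q @ [z]"]) (auto simp: successively_append_iff)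
qed

lemma rtranclp_leaves_set:
  assumes "E\<^sup>*\<^sup>* a b" "a \<in> S" "b \<notin> S"
  obtains s t where "s \<in> S" "t \<notin> S" "E s t"
proof -
  have "\<exists>s t. s \<in> S \<and> t \<notin> S \<and> E s t"
    using assms by (induction rule: rtranclp_induct) blast+
  with that show thesis by blast
qed

lemma successively_take_drop:
  assumes "successively E q"
  shows "successively E (take i q)" "successively E (drop i q)"
  using assms successively_append_iff[of E "take i q" "drop i q"]
  unfolding append_take_drop_id by blast+

section \<open>Strong multipartite tournaments as a relation \<open>E\<close> with class labels
  \<open>K\<close>\<close>

locale strong_multipartite =
  fixes V :: "'a set" and E :: "'a \<Rightarrow> 'a \<Rightarrow> bool" and K :: "'a \<Rightarrow> 'k"
  assumes arc_verts: "E x y \<Longrightarrow> x \<in> V \<and> y \<in> V"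
    and arc_classes: "E x y \<Longrightarrow> K x \<noteq> K y"
    and adjacent: "\<lbrakk>x \<in> V; y \<in> V; K x \<noteq> K y\<rbrakk> \<Longrightarrow> E x y \<or> E y x"
    and asym: "E x y \<Longrightarrow> \<not> E y x"
    and strong: "\<lbrakk>x \<in> V; y \<in> V\<rbrakk> \<Longrightarrow> E\<^sup>*\<^sup>* x y"
begin

text \<open>Makes every result of the locale available with all arcs reversed.\<close>

lemma converse: "strong_multipartite V (\<lambda>x y. E y x) K"
proof (rule strong_multipartite.intro)
  fix x y
  show "E y x \<Longrightarrow> x \<in> V \<and> y \<in> V" using arc_verts[of y x] by simp
  show "E y x \<Longrightarrow> K x \<noteq> K y" using arc_classes[of y x] by simp
  show "E y x \<Longrightarrow> \<not> E x y" by (rule asym)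
  assume V: "x \<in> V" "y \<in> V"
  show "K x \<noteq> K y \<Longrightarrow> E y x \<or> E x y" using adjacent[OF V] by auto
  have "E\<inverse>\<inverse>\<^sup>*\<^sup>* x y" using strong V by (intro rtranclp_converseI)
  moreover have "E\<inverse>\<inverse> = (\<lambda>x y. E y x)" by auto
  ultimately show "(\<lambda>x y. E y x)\<^sup>*\<^sup>* x y" by simp
qed

lemma chain_pair_triangle:
  assumes "E x y" "E y z" "E z x"
  shows "chain_pair E 3"
proof (rule chain_pair_prefix[of "[x, y, z]"])
  fix j :: nat assume "2 \<le> j" "j < length [x, y, z]"
  then have "j = 2" by simp
  then show "E ([x, y, z] ! j) ([x, y, z] ! 0)" using assms by simp
qed (use assms arc_classes[OF assms(1)] arc_classes[OF assms(2)] arc_classes[OF assms(3)] in auto)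

lemma cycle_verts_subset: "is_cycle E C \<Longrightarrow> set C \<subseteq> V"
proof
  fix d assume "is_cycle E C" "d \<in> set C"
  moreover obtain d' where "(d, d') \<in> cycle_arcs C" using is_cycle_out_arc \<open>d \<in> set C\<close> .
  ultimately have "E d d'" by (auto simp: is_cycle_def)
  then show "d \<in> V" using arc_verts by blast
qed

text \<open>
  A shortest walk q from the vertices dominated by C back to C admits no shortcut. If some vertex
  w of q beyond the first avoids the classes of C, then w dominates C and is the last one before C:
  for its predecessor z, the backward walk w, z, C satisfies the hypotheses of
  chain_pair_prefix for the converse relation. Otherwise q followed by C does so itself.
\<close>

lemma chain_pair_dominated:
  assumes cyc: "is_cycle E C" and ne: "C \<noteq> []"
    and unmixed: "\<And>y. \<lbrakk>y \<in> V; K y \<notin> K ` set C\<rbrakk> \<Longrightarrow> (\<forall>d\<in>set C. E d y) \<or> (\<forall>d\<in>set C. E y d)"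
    and x0: "x0 \<in> V" "K x0 \<notin> K ` set C" "\<forall>d\<in>set C. E d x0"
    and n: "3 \<le> n" "n \<le> length C + 2"
  shows "chain_pair E n"
proof -
  have CV: "set C \<subseteq> V" using cycle_verts_subset cyc by blast
  define U where "U = {x \<in> V. K x \<notin> K ` set C \<and> (\<forall>d\<in>set C. E d x)}"
  \<comment> \<open>Any start in \<open>U\<close> is allowed, not only \<open>x0\<close>, so that a
    minimal walk meets \<open>U\<close> in its first vertex alone; \<open>x0\<close> merely shows
    that such walks exist.\<close>
  define W where "W q \<longleftrightarrow> q \<noteq> [] \<and> hd q \<in> U \<and> last q \<in> set C \<and> successively E q" for q
  have "hd C \<in> V" using CV ne by auto
  then have "E\<^sup>*\<^sup>* x0 (hd C)" using strong x0 by blast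
  then have "\<exists>q. W q" using rtranclp_walk[of E x0 "hd C"] x0 ne unfolding W_def U_def by auto
  then obtain q where q: "W q" and min: "\<And>q'. W q' \<Longrightarrow> length q \<le> length q'"
    using ex_has_least_nat[of W _ length] by blast
  have q': "q \<noteq> []" "q ! 0 \<in> U" "last q \<in> set C" "successively E q"
    using q by (auto simp: W_def hd_conv_nth)
  have step: "E (q ! i) (q ! Suc i)" if "Suc i < length q" for i
    using q'(4) that by (simp add: successively_conv_nth)
  have lastq: "last q = q ! (length q - 1)" using q' by (simp add: last_conv_nth)
  have last_take: "last (take (Suc i) q) = q ! i" if "i < length q" for i
    using that by (simp add: take_Suc_conv_app_nth)
  \<comment> \<open>Otherwise the vertices strictly between could be cut out, leaving a shorter walk
    in \<open>W\<close>.\<close>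
  have no_skip: "\<not> E (q ! i) (q ! j)" if "Suc i < j" "j < length q" for i j
  proof
    assume "E (q ! i) (q ! j)"
    then have "successively E (take (Suc i) q @ drop j q)"
      using successively_take_drop[OF q'(4)] last_take[of i] that
      by (simp add: successively_append_iff hd_drop_conv_nth)
    moreover have "hd (take (Suc i) q @ drop j q) = q ! 0" "last (take (Suc i) q @ drop j q) = last q"
      using q'(1) that by (simp_all add: hd_append hd_conv_nth)
    ultimately have "W (take (Suc i) q @ drop j q)"
      using q' unfolding W_def by simp
    from min[OF this] that show False by simp
  qed
  \<comment> \<open>Going from \<open>q ! i\<close> straight into \<open>C\<close> gives a walk of
    \<open>i + 2\<close> vertices in \<open>W\<close>, to be compared with the minimal
    \<open>q\<close>.\<close>
  have no_exit: "length q \<le> Suc (Suc i)" if "E (q ! i) d" "d \<in> set C" "i < length q" for i d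
  proof -
    have "successively E (take (Suc i) q @ [d])"
      using successively_take_drop[OF q'(4)] last_take[of i] that
      by (simp add: successively_append_iff)
    moreover have "hd (take (Suc i) q @ [d]) = q ! 0"
      using q'(1) by (simp add: hd_append hd_conv_nth)
    ultimately have "W (take (Suc i) q @ [d])"
      using q'(2) that(2) unfolding W_def by simp
    from min[OF this] that show ?thesis by simp
  qed
  have no_mid: "Suc j = length q" if "q ! j \<in> set C" "j < length q" for j
  proof -
    have "W (take (Suc j) q)"
      using successively_take_drop(1)[OF q'(4), of "Suc j"] last_take[of j] q'(1,2) that
      unfolding W_def by (simp add: hd_conv_nth)
    from min[OF this] that show ?thesis by simp
  qed
  have no_U: "j = 0" if "q ! j \<in> U" "j < length q" for j
  proof -
    have "W (drop j q)"
      using successively_take_drop(2)[OF q'(4), of j] q'(3) that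
      unfolding W_def by (simp add: hd_drop_conv_nth)
    from min[OF this] that show ?thesis by simp
  qed
  \<comment> \<open>A repetition of \<open>q ! 0\<close> would meet \<open>U\<close> again; a
    repetition of a later vertex would give its predecessor a shortcut.\<close>
  have neq: "q ! i \<noteq> q ! j" if "i < j" "j < length q" for i j
  proof
    assume eq: "q ! i = q ! j"
    show False
    proof (cases i)
      case 0
      then show ?thesis using eq no_U[of j] q' that by simp
    next
      case (Suc k)
      then show ?thesis using eq step[of k] no_skip[of k j] that by simp
    qed
  qed
  have dist: "distinct q" unfolding distinct_conv_nth by (metis neq linorder_neqE_nat)
  have x_dom: "E d (q ! 0)" if "d \<in> set C" for d using q' that by (auto simp: U_def)
  have "q ! 0 \<notin> set C" using q' by (auto simp: U_def)
  then have "length q \<noteq> 1" using q' lastq by auto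
  moreover have "length q \<noteq> 2"
  proof
    assume "length q = 2"
    then have "E (q ! 0) (last q)" using step[of 0] lastq by (simp add: numeral_2_eq_2)
    then show False using x_dom q' asym by blast
  qed
  moreover have "length q \<noteq> 0" using q' by simp
  ultimately have len: "3 \<le> length q" by linarith
  have qV: "q ! j \<in> V" if "j < length q" for j
  proof (cases "Suc j < length q")
    case True then show ?thesis using step arc_verts by blast
  next
    case False then show ?thesis using that lastq q' CV by (auto simp: not_less le_Suc_eq less_Suc_eq_le)
  qed
  show ?thesis
  proof (cases "\<exists>j. 0 < j \<and> j < length q \<and> K (q ! j) \<notin> K ` set C")
    case True
    then obtain j where j: "0 < j" "j < length q" "K (q ! j) \<notin> K ` set C" by blast
    obtain i where i: "j = Suc i" using j(1) gr0_conv_Suc by blast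
    define w z where "w = q ! j" and "z = q ! i"
    \<comment> \<open>Since \<open>j\<close> is positive, \<open>w\<close> lies outside
      \<open>U\<close>, and \<open>unmixed\<close> leaves only that \<open>w\<close> dominates
      \<open>C\<close>.\<close>
    have "w \<notin> U" using no_U j w_def by blast
    then have w: "E w d" if "d \<in> set C" for d
      using unmixed[of w] qV j that unfolding U_def w_def by blast
    have "w \<notin> set C" using j w_def by blast
    \<comment> \<open>As \<open>w\<close> can step straight into \<open>C\<close>, it is the last
      vertex but one of \<open>q\<close>; so an arc from \<open>z\<close> into \<open>C\<close>
      would be a shortcut.\<close>
    then have "Suc j \<noteq> length q" using q'(3) lastq w_def by (metis diff_Suc_1)
    moreover have "length q \<le> Suc (Suc j)"
      using no_exit[OF _ hd_in_set[OF ne] j(2)] w[OF hd_in_set[OF ne]] by (simp add: w_def)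
    ultimately have len_j: "length q = Suc (Suc j)" using j by linarith
    have zw: "E z w" using step[of i] i j(2) by (simp add: w_def z_def)
    have z_no: "\<not> E z d" if "d \<in> set C" for d
      using no_exit[of i d] that i len_j unfolding z_def by linarith
    have "z \<notin> set C" using no_mid[of i] i len_j unfolding z_def by linarith
    \<comment> \<open>Consecutive vertices of \<open>C\<close> have different classes, so
      \<open>z\<close> is adjacent to some \<open>d\<close> in \<open>C\<close>; that arc can only
      go from \<open>d\<close> to \<open>z\<close>.\<close>
    have "\<exists>d\<in>set C. K d \<noteq> K z"
    proof -
      obtain d where "d \<in> set C" "(hd C, d) \<in> cycle_arcs C"
        using is_cycle_out_arc[of "hd C" C] ne by auto
      then have "K (hd C) \<noteq> K d" using cyc arc_classes by (auto simp: is_cycle_def)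
      then show ?thesis using \<open>d \<in> set C\<close> ne by (metis hd_in_set)
    qed
    then obtain d where d: "d \<in> set C" "K d \<noteq> K z" by blast
    have "z \<in> V" using arc_verts zw by blast
    then have dz: "E d z" using adjacent d CV z_no by blast
    obtain m where m: "hd (rotate m (rev C)) = d" using rotate_to_hd[of d "rev C"] d by auto
    let ?R = "rotate m (rev C)"
    have R: "is_cycle (\<lambda>x y. E y x) ?R" using is_cycle_rev[of "\<lambda>x y. E y x" C] cyc by simp
    \<comment> \<open>In the converse the path runs from \<open>w\<close> to \<open>z\<close> to
      \<open>d\<close> and on around the reversed cycle: \<open>length C + 2\<close> vertices, which
      accounts for the bound on \<open>n\<close>.\<close>
    have "chain_pair (\<lambda>x y. E y x) n"
    proof (rule chain_pair_prefix[of "w # z # ?R"])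
      show "distinct (w # z # ?R)"
        using R \<open>w \<notin> set C\<close> \<open>z \<notin> set C\<close> zw asym by (auto simp: is_cycle_def)
      show "successively (\<lambda>x y. E y x) (w # z # ?R)"
        using is_cycle_successively[OF R] zw dz m ne by (auto simp: successively_Cons)
      show "E ((w # z # ?R) ! 0) ((w # z # ?R) ! i)" if "2 \<le> i" "i < length (w # z # ?R)" for i
      proof -
        have "(w # z # ?R) ! i = ?R ! (i - 2)" using that by (auto simp: nth_Cons' numeral_2_eq_2)
        moreover have "?R ! (i - 2) \<in> set ?R" using that by (intro nth_mem) auto
        ultimately show ?thesis using w by simp
      qed
    qed (use n in auto)
    then show ?thesis by (rule chain_pair_converse)
  next
    case False
    obtain m where m: "hd (rotate m C) = last q" using rotate_to_hd[of "last q" C] q' by auto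
    let ?R = "rotate m C"
    have R: "is_cycle E ?R" "?R = last q # tl ?R"
      using cyc m ne by (auto simp flip: m)
    \<comment> \<open>The vertex \<open>last q\<close> belongs to both the walk and the cycle;
      counting it with the cycle makes the two pieces disjoint.\<close>
    have split: "q @ tl ?R = butlast q @ ?R" using R(2) q'(1) by (metis append_butlast_last_id append.assoc append_Cons append_Nil)
    show ?thesis
    proof (rule chain_pair_prefix[of "q @ tl ?R"])
      have "set (butlast q) \<inter> set C = {}"
        using no_mid by (fastforce simp: in_set_conv_nth nth_butlast)
      then show "distinct (q @ tl ?R)"
        unfolding split using dist R(1) by (auto simp: is_cycle_def distinct_butlast)
      show "successively E (q @ tl ?R)"
      proof -
        have "successively E (last q # tl ?R)"
          using is_cycle_successively[OF R(1)] R(2) by argo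
        then show ?thesis using q'(4) by (auto simp: successively_append_iff successively_Cons)
      qed
      show "E ((q @ tl ?R) ! j) ((q @ tl ?R) ! 0)" if j: "2 \<le> j" "j < length (q @ tl ?R)" for j
      proof -
        have 0: "(q @ tl ?R) ! 0 = q ! 0" using q'(1) by (metis nth_append length_greater_0_conv)
        show ?thesis
        proof (cases "j < length q")
          case True
          have "0 < j" using j(1) by simp
          \<comment> \<open>Later vertices of \<open>q\<close> have classes met by \<open>C\<close>,
            so they are adjacent to \<open>q ! 0\<close>; an arc from \<open>q ! 0\<close> would be
            a shortcut, so the arc goes back to \<open>q ! 0\<close>.\<close>
          then have "K (q ! j) \<in> K ` set C" using False True by blast
          moreover have "K (q ! 0) \<notin> K ` set C" using q'(2) by (simp add: U_def)
          ultimately have "K (q ! j) \<noteq> K (q ! 0)" by metis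
          then have "E (q ! j) (q ! 0)"
            using adjacent[OF qV qV, of j 0] True no_skip[of 0 j] j(1) q'(1) by simp
          then show ?thesis using True 0 by (simp add: nth_append)
        next
          case jlen: False
          have "(q @ tl ?R) ! j \<in> set (tl ?R)"
            using jlen j(2) by (simp add: nth_append)
          then have "(q @ tl ?R) ! j \<in> set C"
            by (metis list.set_sel(2) list.sel(2) set_rotate)
          then show ?thesis using x_dom 0 by simp
        qed
      qed
      \<comment> \<open>At least three vertices of \<open>q\<close>, and all of \<open>C\<close>
        except the shared \<open>last q\<close>, give at least \<open>length C + 2\<close>.\<close>
      show "n \<le> length (q @ tl ?R)" using n len ne by (simp add: Suc_diff_le)
    qed (use n in auto)
  qed
qed

text \<open>If \<open>x0\<close> is not dominated by \<open>C\<close>, it dominates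
  \<open>C\<close>, and the converse relation with the reversed cycle applies. Used with
  \<open>n\<close> one above the length of \<open>C\<close> to lengthen chains, and with
  \<open>n = 3\<close> on a 4-cycle to find a 3-cycle.\<close>

lemma chain_pair_unmixed:
  assumes "is_cycle E C" "C \<noteq> []"
    and "\<And>y. \<lbrakk>y \<in> V; K y \<notin> K ` set C\<rbrakk> \<Longrightarrow> (\<forall>d\<in>set C. E d y) \<or> (\<forall>d\<in>set C. E y d)"
    and "x0 \<in> V" "K x0 \<notin> K ` set C" "3 \<le> n" "n \<le> length C + 2"
  shows "chain_pair E n"
proof (cases "\<forall>d\<in>set C. E d x0")
  case True
  then show ?thesis using chain_pair_dominated assms by blast
next
  case False
  then have "\<forall>d\<in>set C. E x0 d" using assms by blast
  moreover have "is_cycle (\<lambda>x y. E y x) (rev C)" using is_cycle_rev[of "\<lambda>x y. E y x"] assms by simp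
  ultimately have "chain_pair (\<lambda>x y. E y x) n"
    using assms by (intro strong_multipartite.chain_pair_dominated[OF converse, of "rev C" x0]) auto
  then show ?thesis by (rule chain_pair_converse)
qed

text \<open>A cycle on \<open>m\<close> vertices meets at most \<open>m\<close> classes, so some
  vertex has a class that \<open>C\<close> misses. Either a vertex of this kind fits into an arc of
  \<open>C\<close>, or none does and \<open>chain_pair_unmixed\<close> applies.\<close>

lemma chain_pair_Suc:
  assumes "chain_pair E m" "m < card (K ` V)"
  shows "chain_pair E (Suc m)"
proof -
  obtain C e1 e2 where C: "length C = m" "e1 \<noteq> e2" "cycle_chain E e1 C" "cycle_chain E e2 C"
    using assms(1) unfolding chain_pair_def by blast
  have cyc: "is_cycle E C" and len: "3 \<le> m" using cycle_chain_is_cycle[OF C(3)] C(1) by auto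
  have "card (K ` set C) \<le> m" using C(1) by (metis card_image_le card_length le_trans List.finite_set)
  then have "\<not> K ` V \<subseteq> K ` set C"
    using assms(2) card_mono[of "K ` set C" "K ` V"] by auto
  then obtain x0 where x0: "x0 \<in> V" "K x0 \<notin> K ` set C" by auto
  have CV: "set C \<subseteq> V" using cycle_verts_subset cyc by blast
  show ?thesis
  proof (cases "\<exists>x a b. x \<in> V \<and> K x \<notin> K ` set C \<and> (a, b) \<in> cycle_arcs C \<and> E a x \<and> E x b")
    case True
    then obtain x a b where x: "x \<in> V" "K x \<notin> K ` set C" "(a, b) \<in> cycle_arcs C" "E a x" "E x b"
      by blast
    have "E x y \<or> E y x" if "y \<in> set C" for y
    proof -
      have "K x \<noteq> K y" using x(2) that by blast
      then show ?thesis using adjacent x(1) CV that by blast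
    qed
    then show ?thesis using chain_pair_insert[OF C(3,4,2), of x a b] x C(1) by blast
  next
    case False
    have "(\<forall>d\<in>set C. E d y) \<or> (\<forall>d\<in>set C. E y d)" if y: "y \<in> V" "K y \<notin> K ` set C" for y
    proof (rule disjCI)
      assume "\<not> (\<forall>d\<in>set C. E y d)"
      moreover have adj: "E d y \<or> E y d" if "d \<in> set C" for d
        using adjacent[of d y] y that CV by (metis image_eqI subsetD)
      ultimately obtain d where d: "d \<in> set C" "E d y" by blast
      show "\<forall>d\<in>set C. E d y"
      proof
        fix d' assume "d' \<in> set C"
        show "E d' y"
        \<comment> \<open>If \<open>u\<close> dominates \<open>y\<close> and \<open>y\<close>
          dominated the next vertex \<open>v\<close>, then \<open>y\<close> would fit into
          \<open>(u, v)\<close>. So the property of dominating \<open>y\<close> passes around the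
          cycle.\<close>
        proof (rule cycle_closed[where Q = "\<lambda>z. E z y", OF d])
          fix u v assume uv: "(u, v) \<in> cycle_arcs C" "E u y"
          then have "v \<in> set C"
            by (auto simp: cycle_arcs_def dest: set_zip_rightD)
          then show "E v y" using False uv y adj by blast
        qed fact
      qed
    qed
    moreover have "C \<noteq> []" "Suc m \<le> length C + 2" "3 \<le> Suc m" using C(1) len by auto
    ultimately show ?thesis using chain_pair_unmixed[OF cyc _ _ x0] by blast
  qed
qed

text \<open>Either a 3-cycle appears near an arbitrary vertex \<open>v\<close>, or there is a
  4-cycle on two classes. In the latter case a digraph without 3-cycles would leave this 4-cycle
  unmixed, and \<open>chain_pair_unmixed\<close> would produce one after all.\<close>

lemma chain_pair_3:
  assumes "3 \<le> card (K ` V)"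
  shows "chain_pair E 3"
proof -
  have third: "\<exists>x\<in>V. K x \<notin> {a, b}" for a b
  proof (rule ccontr)
    assume "\<not> (\<exists>x\<in>V. K x \<notin> {a, b})"
    then have "card (K ` V) \<le> card {a, b}" by (intro card_mono) auto
    also have "card {a, b} \<le> 2" by (simp add: card_insert_if)
    finally show False using assms by simp
  qed
  obtain v where v: "v \<in> V" using third by blast
  obtain v' where v': "v' \<in> V" "K v' \<noteq> K v" using third[of "K v" "K v"] by blast
  \<comment> \<open>An arc from an out-neighbour of \<open>v\<close> into the class of
    \<open>v\<close> stays in \<open>S\<close>, since \<open>asym\<close> keeps it from ending in
    \<open>v\<close>. So an arc leaving \<open>S\<close> ends in another class, at a
    \<open>t\<close> that is no out-neighbour of \<open>v\<close> and hence dominates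
    \<open>v\<close>.\<close>
  define S where "S = {u. E v u} \<union> {y. K y = K v \<and> y \<noteq> v \<and> (\<exists>u. E v u \<and> E u y)}"
  obtain u0 where "E v u0" using strong[OF v v'(1)] v' by (metis converse_rtranclpE)
  then have "u0 \<in> S" "E\<^sup>*\<^sup>* u0 v" using strong arc_verts by (auto simp: S_def)
  moreover have "v \<notin> S" using asym by (auto simp: S_def)
  ultimately obtain s t where st: "s \<in> S" "t \<notin> S" "E s t" using rtranclp_leaves_set by metis
  have tv: "E t v" if "K t \<noteq> K v"
    using adjacent[OF v, of t] st that arc_verts by (auto simp: S_def)
  show ?thesis
  proof (cases "E v s")
    case True
    then have "K t \<noteq> K v" using st asym by (auto simp: S_def)
    then show ?thesis using chain_pair_triangle True st tv by blast
  next
    case False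
    then obtain u where u: "K s = K v" "s \<noteq> v" "E v u" "E u s" using st by (auto simp: S_def)
    have "K t \<noteq> K v" using u st arc_classes by metis
    then have "E t v" by (rule tv)
    show ?thesis
    proof (cases "K u = K t")
      case False
      \<comment> \<open>An arc from \<open>u\<close> to \<open>t\<close> closes the triangle
        \<open>v, u, t\<close>; the opposite arc closes \<open>u, s, t\<close>.\<close>
      then have "E u t \<or> E t u" using adjacent arc_verts u st by blast
      then show ?thesis using chain_pair_triangle u st \<open>E t v\<close> by blast
    next
      case True
      \<comment> \<open>With \<open>u\<close> and \<open>t\<close> in one class, this 4-cycle meets
        only the classes of \<open>v\<close> and \<open>u\<close>, so \<open>third\<close> gives a
        vertex outside them.\<close>
      let ?C = "[v, u, s, t]"
      have "u \<noteq> t" using u st asym by blast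
      then have cyc: "is_cycle E ?C"
        using u st \<open>E t v\<close> asym by (auto simp: is_cycle_def cycle_arcs_def)
      obtain x0 where x0: "x0 \<in> V" "K x0 \<notin> K ` set ?C"
        using third[of "K v" "K u"] u True by auto
      have CV: "set ?C \<subseteq> V" using cycle_verts_subset cyc by blast
      show ?thesis
      proof (rule ccontr)
        assume no: "\<not> ?thesis"
        have "(\<forall>d\<in>set ?C. E d y) \<or> (\<forall>d\<in>set ?C. E y d)" if y: "y \<in> V" "K y \<notin> K ` set ?C" for y
        proof (subst disj_commute, rule disjCI)
          assume "\<not> (\<forall>d\<in>set ?C. E d y)"
          moreover have adj: "E d y \<or> E y d" if "d \<in> set ?C" for d
            using adjacent[of d y] y that CV by (metis image_eqI subsetD)
          ultimately obtain d where d: "d \<in> set ?C" "E y d" by blast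
          show "\<forall>d\<in>set ?C. E y d"
          proof
            fix d' assume "d' \<in> set ?C"
            show "E y d'"
            \<comment> \<open>An arc from \<open>b\<close> to \<open>y\<close> would complete the
              triangle \<open>y, a, b\<close>; so \<open>y\<close> dominates \<open>b\<close> as
              well.\<close>
            proof (rule cycle_closed[where Q = "E y", OF d])
              fix a b assume ab: "(a, b) \<in> cycle_arcs ?C" "E y a"
              then have "E a b" "b \<in> set ?C" using cyc
                by (auto simp: is_cycle_def cycle_arcs_def)
              then show "E y b" using no ab chain_pair_triangle[of y a b] adj by blast
            qed fact
          qed
        qed
        then show False using chain_pair_unmixed[OF cyc _ _ x0, of 3] no by auto
      qed
    qed
  qed
qed

lemma chain_pair_classes:
  assumes "3 \<le> card (K ` V)"
  shows "chain_pair E (card (K ` V))"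
proof -
  have "chain_pair E n" if "3 \<le> n" "n \<le> card (K ` V)" for n
    using that
  proof (induction n rule: dec_induct)
    case base
    then show ?case using assms by (intro chain_pair_3)
  next
    case (step n)
    then show ?case by (intro chain_pair_Suc) auto
  qed
  with assms show ?thesis by blast
qed

end

section \<open>From chains of vertex lists to families of cycles given by arc lists\<close>

lemma cycle_chain_chain:
  assumes "cycle_chain E e xs"
  shows "\<exists>C. C (length xs) = xs \<and>
    (\<forall>m\<in>{3..length xs}. is_cycle E (C m) \<and> length (C m) = m \<and> e \<in> cycle_arcs (C m)) \<and>
    (\<forall>m\<in>{3..<length xs}. set (C m) \<subset> set (C (Suc m)))"
  using assms
proof (induction rule: cycle_chain.induct)
  case (triangle xs)
  \<comment> \<open>Only the index 3 counts and the nesting condition is empty, so a constant family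
    works.\<close>
  then show ?case by (intro exI[of _ "\<lambda>_. xs"]) auto
next
  case (extend xs ys)
  then obtain C where C: "C (length xs) = xs"
    "\<forall>m\<in>{3..length xs}. is_cycle E (C m) \<and> length (C m) = m \<and> e \<in> cycle_arcs (C m)"
    "\<forall>m\<in>{3..<length xs}. set (C m) \<subset> set (C (Suc m))"
    by blast
  show ?case
    by (rule exI[of _ "C(length ys := ys)"])
      (use C extend.hyps in \<open>auto simp: le_Suc_eq less_Suc_eq\<close>)
qed

text \<open>Here \<open>f x y\<close> is meant to be an arc from \<open>x\<close> to
  \<open>y\<close>. The closing arc comes last, so the length equals the number of vertices.\<close>

definition vertex_arcs :: "('a \<Rightarrow> 'a \<Rightarrow> 'b) \<Rightarrow> 'a list \<Rightarrow> 'b list" where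
  "vertex_arcs f xs = map (\<lambda>(x, y). f x y) (zip xs (rotate1 xs))"

lemma length_vertex_arcs [simp]: "length (vertex_arcs f xs) = length xs"
  by (simp add: vertex_arcs_def)

lemma set_vertex_arcs: "set (vertex_arcs f xs) = (\<lambda>(x, y). f x y) ` cycle_arcs xs"
  by (simp add: vertex_arcs_def cycle_arcs_def)

context pre_digraph
begin

lemma awalk_of_verts:
  assumes "\<And>x y. (x, y) \<in> set (zip (u # us) us) \<Longrightarrow> tail G (f x y) = x \<and> head G (f x y) = y"
  defines "p \<equiv> map (\<lambda>(x, y). f x y) (zip (u # us) us)"
  shows "cas u p (last (u # us)) \<and> awalk_verts u p = u # us"
  using assms(1) unfolding p_def
proof (induction us arbitrary: u)
  case (Cons v vs)
  have "cas v (map (\<lambda>(x, y). f x y) (zip (v # vs) vs)) (last (v # vs)) \<and>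
      awalk_verts v (map (\<lambda>(x, y). f x y) (zip (v # vs) vs)) = v # vs"
    using Cons.prems by (intro Cons.IH) auto
  moreover have "tail G (f u v) = u" "head G (f u v) = v" using Cons.prems by auto
  ultimately show ?case by simp
qed simp

text \<open>The walk visits \<open>u # us @ [u]\<close>; what \<open>cycle\<close> demands is
  distinctness of its tail \<open>us @ [u]\<close>, and the repeated \<open>u\<close> does not
  change the vertex set.\<close>

lemma cycle_vertex_arcs:
  assumes f: "\<And>x y. E x y \<Longrightarrow> f x y \<in> arcs G \<and> tail G (f x y) = x \<and> head G (f x y) = y"
    and V: "\<And>x y. E x y \<Longrightarrow> x \<in> verts G"
    and xs: "is_cycle E xs" "xs \<noteq> []"
  shows "cycle (vertex_arcs f xs)" "cycle_verts (vertex_arcs f xs) = set xs"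
proof -
  obtain u us where u: "xs = u # us" using xs(2) by (cases xs) auto
  \<comment> \<open>As \<open>zip\<close> stops at the shorter list, the first argument may be
    extended by \<open>u\<close> to match \<open>awalk_of_verts\<close>.\<close>
  have "zip (u # us) (us @ [u]) = zip (u # us @ [u]) (us @ [u])"
    using zip_append1[of "u # us" "[u]" "us @ [u]"] by simp
  then have p: "vertex_arcs f xs = map (\<lambda>(x, y). f x y) (zip (u # us @ [u]) (us @ [u]))"
    and arcs: "cycle_arcs xs = set (zip (u # us @ [u]) (us @ [u]))"
    by (simp_all add: vertex_arcs_def cycle_arcs_def u)
  have E: "E x y" if "(x, y) \<in> cycle_arcs xs" for x y
    using xs(1) that by (auto simp: is_cycle_def)
  have walk: "cas u (vertex_arcs f xs) u" "awalk_verts u (vertex_arcs f xs) = u # us @ [u]"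
    using awalk_of_verts[of u "us @ [u]" f] E f unfolding p arcs by auto
  obtain v where "(u, v) \<in> cycle_arcs xs" using is_cycle_out_arc[of u xs] u by auto
  then have "u \<in> verts G" using E V by blast
  moreover have "set (vertex_arcs f xs) \<subseteq> arcs G"
    using E f by (auto simp: set_vertex_arcs)
  ultimately have "awalk u (vertex_arcs f xs) u" using walk by (simp add: awalk_def)
  moreover have "distinct (us @ [u])" using xs(1) u by (auto simp: is_cycle_def)
  moreover have ne: "vertex_arcs f xs \<noteq> []" using xs(2) by (metis length_vertex_arcs length_0_conv)
  ultimately show "cycle (vertex_arcs f xs)" using walk by (auto simp: cycle_def)
  have "tail G (hd (vertex_arcs f xs)) = u"
    using walk(1) ne by (cases "vertex_arcs f xs") auto
  then show "cycle_verts (vertex_arcs f xs) = set xs"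
    using walk(2) u by (simp add: cycle_verts_def)
qed

end

section \<open>Partite sets as class labels, and the transfer to the given digraph\<close>

context multipartite_tournament
begin

text \<open>For a vertex this is the singleton of its partite set, a label obtained without a
  choice.\<close>

abbreviation partite_class :: "'a \<Rightarrow> 'a set set" where
  "partite_class x \<equiv> {X \<in> P. x \<in> X}"

lemma partite_class_eq: "X \<in> P \<Longrightarrow> x \<in> X \<Longrightarrow> partite_class x = {X}"
  using partite_sets unfolding partition_on_def disjoint_def by blast

text \<open>Distinct blocks have distinct singletons, and each block, being nonempty, supplies a
  vertex with its label.\<close>

lemma card_partite_classes: "card (partite_class ` verts D) = c"
proof -
  have "partite_class ` verts D = (\<lambda>X. {X}) ` P" (is "?L = ?R")
  proof
    show "?L \<subseteq> ?R"
    proof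
      fix Z assume "Z \<in> ?L"
      then obtain x X where "x \<in> X" "X \<in> P" "Z = partite_class x"
        using partite_sets unfolding partition_on_def by blast
      then show "Z \<in> ?R" using partite_class_eq by blast
    qed
    show "?R \<subseteq> ?L"
    proof
      fix Z assume "Z \<in> ?R"
      then obtain X where X: "X \<in> P" "Z = {X}" by blast
      then have "X \<noteq> {}" using partite_sets by (auto simp: partition_on_def)
      then obtain x where "x \<in> X" by blast
      then show "Z \<in> ?L" using X partite_class_eq[of X x] partite_sets
        by (auto simp: partition_on_def intro!: image_eqI[of _ _ x])
    qed
  qed
  then show ?thesis using card_partite_sets by (simp add: card_image)
qed

lemma strong_multipartite:
  assumes "strongly_connected D"
  shows "strong_multipartite (verts D) (\<lambda>x y. x \<rightarrow>\<^bsub>D\<^esub> y) partite_class"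
proof (rule strong_multipartite.intro)
  fix x y
  show V: "x \<in> verts D \<and> y \<in> verts D" if "x \<rightarrow>\<^bsub>D\<^esub> y" using that adj_in_verts by blast
  show cls: "partite_class x \<noteq> partite_class y" if xy: "x \<rightarrow>\<^bsub>D\<^esub> y"
  proof
    assume eq: "partite_class x = partite_class y"
    obtain X where X: "X \<in> P" "x \<in> X" using V[OF xy] partite_sets by (auto simp: partition_on_def)
    then have "y \<in> X" using eq by blast
    then show False using no_arc_within X xy by blast
  qed
  have between: "(x \<rightarrow>\<^bsub>D\<^esub> y) \<noteq> (y \<rightarrow>\<^bsub>D\<^esub> x)"
    if xy: "x \<in> verts D" "y \<in> verts D" "partite_class x \<noteq> partite_class y" for x y
  proof -
    obtain X Y where XY: "X \<in> P" "x \<in> X" "Y \<in> P" "y \<in> Y"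
      using xy(1,2) partite_sets unfolding partition_on_def by blast
    then have "X \<noteq> Y" using xy(3) partite_class_eq by metis
    then show ?thesis using one_arc_between XY by blast
  qed
  show "\<not> y \<rightarrow>\<^bsub>D\<^esub> x" if "x \<rightarrow>\<^bsub>D\<^esub> y"
    using between V[OF that] cls[OF that] that by blast
  assume xy: "x \<in> verts D" "y \<in> verts D"
  then show "x \<rightarrow>\<^bsub>D\<^esub> y \<or> y \<rightarrow>\<^bsub>D\<^esub> x" if "partite_class x \<noteq> partite_class y"
    using between that by blast
  have "x \<rightarrow>\<^sup>*\<^bsub>D\<^esub> y" using assms xy by (auto simp: strongly_connected_def)
  then have "(x, y) \<in> (arcs_ends D)\<^sup>*" by (rule reachable_rtranclI)
  then show "(\<lambda>x y. x \<rightarrow>\<^bsub>D\<^esub> y)\<^sup>*\<^sup>* x y"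
    by (simp add: rtranclp_rtrancl_eq)
qed

end

theorem theorem3:
  fixes D :: "('a, 'b) pre_digraph" and c :: nat and P :: "'a set set"
  assumes "c \<ge> 3"
    and "multipartite_tournament D c P"
    and "strongly_connected D"
  shows "\<exists>e1\<in>arcs D. \<exists>e2\<in>arcs D. e1 \<noteq> e2 \<and>
    (\<forall>e\<in>{e1, e2}. \<exists>C :: nat \<Rightarrow> 'b awalk.
      (\<forall>m\<in>{3..c}. pre_digraph.cycle D (C m) \<and> length (C m) = m \<and> e \<in> set (C m)) \<and>
      (\<forall>m\<in>{3..<c}. pre_digraph.cycle_verts D (C m) \<subset> pre_digraph.cycle_verts D (C (Suc m))))"
proof -
  interpret multipartite_tournament D c P by fact
  let ?E = "\<lambda>x y. x \<rightarrow>\<^bsub>D\<^esub> y"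
  interpret strong_multipartite "verts D" ?E partite_class
    using strong_multipartite assms(3) .
  have "chain_pair ?E c"
    using chain_pair_classes assms(1) unfolding card_partite_classes .
  then obtain xs p1 p2 where xs: "length xs = c" "p1 \<noteq> p2" "cycle_chain ?E p1 xs" "cycle_chain ?E p2 xs"
    unfolding chain_pair_def by blast
  \<comment> \<open>Chooses an arc with the given ends; one exists whenever \<open>x\<close>
    dominates \<open>y\<close>.\<close>
  define f where "f x y = (SOME e. e \<in> arcs D \<and> tail D e = x \<and> head D e = y)" for x y
  have f: "f x y \<in> arcs D \<and> tail D (f x y) = x \<and> head D (f x y) = y" if "x \<rightarrow>\<^bsub>D\<^esub> y" for x y
    unfolding f_def by (rule someI_ex) (use that in \<open>auto simp: arcs_ends_conv\<close>)
  have chain: "\<exists>C :: nat \<Rightarrow> 'b awalk.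
      (\<forall>m\<in>{3..c}. cycle (C m) \<and> length (C m) = m \<and> (\<lambda>(x, y). f x y) p \<in> set (C m)) \<and>
      (\<forall>m\<in>{3..<c}. cycle_verts (C m) \<subset> cycle_verts (C (Suc m)))" if p: "cycle_chain ?E p xs" for p
  proof -
    obtain C where C: "\<forall>m\<in>{3..c}. is_cycle ?E (C m) \<and> length (C m) = m \<and> p \<in> cycle_arcs (C m)"
      "\<forall>m\<in>{3..<c}. set (C m) \<subset> set (C (Suc m))"
      using cycle_chain_chain[OF p] unfolding xs(1) by blast
    have cyc: "cycle (vertex_arcs f (C m)) \<and> cycle_verts (vertex_arcs f (C m)) = set (C m)"
      if "m \<in> {3..c}" for m
    proof -
      have "is_cycle ?E (C m)" "C m \<noteq> []" using C(1) that by fastforce+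
      then show ?thesis using cycle_vertex_arcs[of ?E f "C m"] f arc_verts by blast
    qed
    show ?thesis
      by (rule exI[of _ "\<lambda>m. vertex_arcs f (C m)"]) (use C cyc in \<open>auto simp: set_vertex_arcs\<close>)
  qed
  have arc: "case p of (x, y) \<Rightarrow> x \<rightarrow>\<^bsub>D\<^esub> y" if "cycle_chain ?E p xs" for p
    using cycle_chain_is_cycle[OF that] by (auto simp: is_cycle_def)
  obtain x1 y1 x2 y2 where p: "p1 = (x1, y1)" "p2 = (x2, y2)" by fastforce
  have "x1 \<rightarrow>\<^bsub>D\<^esub> y1" "x2 \<rightarrow>\<^bsub>D\<^esub> y2"
    using arc[OF xs(3)] arc[OF xs(4)] p by auto
  \<comment> \<open>The tail and head of an arc recover the pair it was chosen for, so distinct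
    pairs give distinct arcs.\<close>
  then have "f x1 y1 \<noteq> f x2 y2" using f xs(2) unfolding p by metis
  moreover have "f x1 y1 \<in> arcs D" "f x2 y2 \<in> arcs D"
    using f arc[OF xs(3)] arc[OF xs(4)] unfolding p by auto
  ultimately show ?thesis using chain[OF xs(3)] chain[OF xs(4)] unfolding p
    by (intro bexI[of _ "f x1 y1"] bexI[of _ "f x2 y2"] conjI ballI) auto
qed

end
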